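(* Let $X$ be a compact ultrametric space. Then: (i) $\mathscr{W}_1(X)$ is a geodesic space; (ii) for every real $p>1$, $\mathscr{W}_p(X)$ is connected by $\frac1p$-Hölder arcs (any two points of $\mathscr{W}_p(X)$ are the endpoints of a $\frac1p$-Hölder arc), but for every $\alpha>\frac1p$, any $\alpha$-Hölder arc in $\mathscr{W}_p(X)$ is constant.
   Context: An ultrametric space is a metric space $(X,d)$ with $d(x,z)\le\max(d(x,y),d(y,z))$ for all $x,y,z\in X$. For a compact metric space $X$ and $p\in[1,+\infty)$, $\mathscr{W}_p(X)=(\mathcal{P}(X),\mathrm{W}_p)$ is the set of Borel probability measures on $X$ endowed with the distance $$\mathrm{W}_p(\mu,\nu)=\left(\inf_{\Pi\in\Gamma(\mu,\nu)}\int_{X\times X}d(a,b)^p\,\Pi(\mathrm{d}a\,\mathrm{d}b)\right)^{1/p},$$ where $\Gamma(\mu,\nu)$ is the set of Borel probability measures on $X\times X$ with marginals $\mu$ and $\nu$. A metric space is geodesic if any two points $x,y$ are joined by a curve $\gamma:[0,1]\to X$ with $\gamma(0)=x$, $\gamma(1)=y$ and $d(\gamma(s),\gamma(t))=|s-t|\,d(x,y)$ for all $s,t$. An $\alpha$-Hölder arc in a metric space $(Z,d_Z)$ is a map $\gamma:[0,1]\to Z$ for which there is a constant $C$ with $d_Z(\gamma(s),\gamma(t))\le C|s-t|^\alpha$ for all $s,t\in[0,1]$. *)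

theory Defs
  imports "HOL-Probability.Probability"
begin

definition ultrametric_on :: "'a::metric_space set \<Rightarrow> bool" where
  "ultrametric_on X \<longleftrightarrow>
     (\<forall>x\<in>X. \<forall>y\<in>X. \<forall>z\<in>X. dist x z \<le> max (dist x y) (dist y z))"

text \<open>
  Borel sets of a subspace are the traces of the ambient Borel sets, hence
  the use of \<^const>\<open>restrict_space\<close> here and on \<open>X \<times> X\<close> below.
\<close>
definition borel_probs :: "'a::topological_space set \<Rightarrow> 'a measure set" where
  "borel_probs X = {\<mu>. prob_space \<mu> \<and> sets \<mu> = sets (restrict_space borel X)}"

definition couplings ::
  "'a::topological_space set \<Rightarrow> 'a measure \<Rightarrow> 'a measure \<Rightarrow> ('a \<times> 'a) measure set" where
  "couplings X \<mu> \<nu> =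
     {\<pi> \<in> borel_probs (X \<times> X).
        distr \<pi> (restrict_space borel X) fst = \<mu> \<and>
        distr \<pi> (restrict_space borel X) snd = \<nu>}"

text \<open>
  A real-valued definition, meant for compact \<open>X\<close>: the cost is then bounded and
  continuous on \<open>X \<times> X\<close>, so the Bochner integral is the usual one, and for
  \<open>\<mu>, \<nu> \<in> borel_probs X\<close> the infimum ranges over a nonempty set of nonnegative reals
  (the product measure is a coupling).
\<close>
definition wasserstein ::
  "'a::metric_space set \<Rightarrow> real \<Rightarrow> 'a measure \<Rightarrow> 'a measure \<Rightarrow> real" where
  "wasserstein X p \<mu> \<nu> =
     (INF \<pi> \<in> couplings X \<mu> \<nu>. (\<integral>(a, b). dist a b powr p \<partial>\<pi>)) powr (1 / p)"

definition geodesic_space :: "'b set \<Rightarrow> ('b \<Rightarrow> 'b \<Rightarrow> real) \<Rightarrow> bool" where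
  "geodesic_space M d \<longleftrightarrow>
     Metric_space M d \<and>
     (\<forall>x\<in>M. \<forall>y\<in>M. \<exists>\<gamma> :: real \<Rightarrow> 'b.
        \<gamma> \<in> {0..1} \<rightarrow> M \<and> \<gamma> 0 = x \<and> \<gamma> 1 = y \<and>
        (\<forall>s\<in>{0..1}. \<forall>t\<in>{0..1}. d (\<gamma> s) (\<gamma> t) = \<bar>s - t\<bar> * d x y))"

definition holder_arc ::
  "'b set \<Rightarrow> ('b \<Rightarrow> 'b \<Rightarrow> real) \<Rightarrow> real \<Rightarrow> (real \<Rightarrow> 'b) \<Rightarrow> bool" where
  "holder_arc M d \<alpha> \<gamma> \<longleftrightarrow>
     \<gamma> \<in> {0..1} \<rightarrow> M \<and>
     (\<exists>C. \<forall>s\<in>{0..1}. \<forall>t\<in>{0..1}. d (\<gamma> s) (\<gamma> t) \<le> C * \<bar>s - t\<bar> powr \<alpha>)"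

end

theory Submission
  imports Defs
begin

text \<open>
  Everything rests on linear interpolation \<open>\<gamma> t = (1 - t) \<mu> + t \<nu>\<close>. If \<open>(Y, Z)\<close> has law
  \<open>\<pi>\<close>, a coupling of \<open>\<mu>\<close> and \<open>\<nu>\<close>, and \<open>U\<close> is uniform on \<open>[0, 1]\<close> and independent of it, then
  \<open>if U < t then Z else Y\<close> has law \<open>\<gamma> t\<close>, and using the same \<open>U\<close> for \<open>s\<close> and \<open>t\<close> couples
  \<open>\<gamma> s\<close> and \<open>\<gamma> t\<close> with cost \<open>\<bar>s - t\<bar>\<close> times that of \<open>\<pi>\<close>. So \<open>W\<^sub>p (\<gamma> s) (\<gamma> t)\<close> is at most
  \<open>\<bar>s - t\<bar> powr (1 / p)\<close> times \<open>W\<^sub>p \<mu> \<nu>\<close>, and for \<open>p = 1\<close> the triangle inequality forces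
  equality.

  Conversely, in an ultrametric space a pair of points separated by a ball of radius \<open>r\<close> is at
  distance at least \<open>r\<close>, whence \<open>r powr p * \<bar>\<mu> B - \<nu> B\<bar>\<close> is at most the \<open>p\<close>-th power of
  \<open>W\<^sub>p \<mu> \<nu>\<close> for every such ball \<open>B\<close>. Along an \<open>\<alpha>\<close>-Hoelder arc the mass of \<open>B\<close> is therefore
  Hoelder continuous of exponent \<open>\<alpha> p > 1\<close>, hence constant, and the balls determine the measure.
\<close>

section \<open>Borel sets of a compact metric space and of its square\<close>

abbreviation borel_of :: "'a::topological_space set \<Rightarrow> 'a measure" where
  "borel_of X \<equiv> restrict_space borel X"

abbreviation transport_cost :: "real \<Rightarrow> ('a::metric_space \<times> 'a) measure \<Rightarrow> real" where
  "transport_cost p \<pi> \<equiv> (\<integral>z. dist (fst z) (snd z) powr p \<partial>\<pi>)"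

lemma borel_probsD:
  assumes "\<mu> \<in> borel_probs X"
  shows "prob_space \<mu>" "sets \<mu> = sets (borel_of X)" "space \<mu> = X"
proof -
  show "prob_space \<mu>" and s: "sets \<mu> = sets (borel_of X)"
    using assms by (auto simp: borel_probs_def)
  show "space \<mu> = X"
    using sets_eq_imp_space_eq[OF s] by (simp add: space_restrict_space)
qed

lemma measurable_fst_borel_of: "fst \<in> measurable (borel_of (X \<times> Y)) (borel_of X)"
  and measurable_snd_borel_of: "snd \<in> measurable (borel_of (X \<times> Y)) (borel_of Y)"
  by (auto intro!: measurable_restrict_space3 borel_measurable_continuous_onI continuous_intros)

text \<open>Compactness supplies a finite net of radius \<open>1 / (n + 1)\<close> for every
  \<open>n\<close>; the union of these nets is the dense set. All later arguments by countable
  covers of \<open>X\<close> start from it.\<close>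

lemma compact_separable:
  fixes X :: "'a::metric_space set"
  assumes "compact X"
  obtains D where "countable D" "D \<subseteq> X" "\<And>x e. x \<in> X \<Longrightarrow> 0 < e \<Longrightarrow> \<exists>y\<in>D. dist x y < e"
proof -
  have "\<exists>k. finite k \<and> k \<subseteq> X \<and> X \<subseteq> (\<Union>x\<in>k. ball x (inverse (Suc n)))" for n
  proof -
    have "X \<subseteq> (\<Union>x\<in>X. ball x (inverse (Suc n)))" by auto
    then show ?thesis
      using compactE_image[OF assms, of X "\<lambda>x. ball x (inverse (Suc n))"] by (metis open_ball)
  qed
  then obtain k where k: "\<And>n. finite (k n)" "\<And>n. k n \<subseteq> X"
      "\<And>n. X \<subseteq> (\<Union>x\<in>k n. ball x (inverse (Suc n)))"
    by metis
  show thesis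
  proof (rule that[of "\<Union>n. k n"])
    show "countable (\<Union>n. k n)" using k(1) by (auto intro: countable_finite)
    show "(\<Union>n. k n) \<subseteq> X" using k(2) by auto
    fix x e assume "x \<in> X" "(0::real) < e"
    then obtain n where "inverse (Suc n) < e" using reals_Archimedean by blast
    moreover obtain y where "y \<in> k n" "dist y x < inverse (Suc n)"
      using k(3)[of n] \<open>x \<in> X\<close> by auto
    ultimately show "\<exists>y\<in>\<Union>n. k n. dist x y < e"
      by (auto simp: dist_commute intro!: exI[of _ n] bexI[of _ y])
  qed
qed

text \<open>With \<open>D\<close> countable, this makes the balls of radius
  \<open>1 / (n + 1)\<close> about points of \<open>D\<close> a countable base. A radius below
  \<open>e / 2\<close> leaves room for the triangle inequality.\<close>

lemma dense_ball_refinement: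
  fixes X :: "'a::metric_space set"
  assumes D: "\<And>x e. x \<in> X \<Longrightarrow> 0 < e \<Longrightarrow> \<exists>y\<in>D. dist x y < e"
    and x: "x \<in> X" "0 < e"
  shows "\<exists>y\<in>D. \<exists>n. x \<in> ball y (inverse (Suc n)) \<and> ball y (inverse (Suc n)) \<subseteq> ball x e"
proof -
  obtain n where n: "inverse (real (Suc n)) < e / 2" using reals_Archimedean[of "e/2"] x by auto
  obtain y where y: "y \<in> D" "dist x y < inverse (real (Suc n))"
    using D[OF x(1), of "inverse (real (Suc n))"] by auto
  have "ball y (inverse (Suc n)) \<subseteq> ball x e"
  proof
    fix z assume "z \<in> ball y (inverse (Suc n))"
    then show "z \<in> ball x e"
      using y n dist_triangle[of x z y] by simp
  qed
  moreover have "x \<in> ball y (inverse (Suc n))" using y by (simp add: dist_commute)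
  ultimately show ?thesis using y(1) by blast
qed

text \<open>The second assumption says that the identity from \<open>N\<close> to the Borel space is
  measurable, and the preimage of a Borel subset of \<open>X\<close> under the identity is that
  subset.\<close>

lemma sets_borel_of_subset:
  assumes "space N = X" and "\<And>S. open S \<Longrightarrow> S \<inter> X \<in> sets N"
  shows "sets (borel_of X) \<subseteq> sets N"
proof
  fix A assume A: "A \<in> sets (borel_of X)"
  have "(\<lambda>z. z) \<in> borel_measurable N"
    using assms by (intro borel_measurableI) simp
  then have "(\<lambda>z. z) \<in> measurable N (borel_of X)"
    using assms(1) by (intro measurable_restrict_space2) auto
  from measurable_sets[OF this A] have "A \<inter> X \<in> sets N" by (simp add: assms(1))
  moreover have "A \<subseteq> X" using sets.sets_into_space[OF A] by (simp add: space_restrict_space)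
  ultimately show "A \<in> sets N" by (simp add: Int_absorb2)
qed

text \<open>Couplings live on the Borel sets of the square, while pairs of measurable maps are
  measurable into the product sigma-algebra. The two agree because, by separability, every open
  subset of the square is a countable union of boxes.\<close>

lemma sets_borel_of_Times:
  fixes X :: "'a::metric_space set"
  assumes "compact X"
  shows "sets (borel_of (X \<times> X)) = sets (borel_of X \<Otimes>\<^sub>M borel_of X)"
proof (rule antisym)
  let ?N = "borel_of X \<Otimes>\<^sub>M borel_of X"
  show "sets ?N \<subseteq> sets (borel_of (X \<times> X))"
  proof (rule sets_pair_in_sets)
    fix a b assume "a \<in> sets (borel_of X)" "b \<in> sets (borel_of X)"
    then have "fst -` a \<inter> space (borel_of (X \<times> X)) \<in> sets (borel_of (X \<times> X))"
       "snd -` b \<inter> space (borel_of (X \<times> X)) \<in> sets (borel_of (X \<times> X))"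
      by (auto intro: measurable_sets[OF measurable_fst_borel_of] measurable_sets[OF measurable_snd_borel_of])
    then have "(fst -` a \<inter> space (borel_of (X \<times> X))) \<inter> (snd -` b \<inter> space (borel_of (X \<times> X)))
        \<in> sets (borel_of (X \<times> X))" by (rule sets.Int)
    also have "(fst -` a \<inter> space (borel_of (X \<times> X))) \<inter> (snd -` b \<inter> space (borel_of (X \<times> X))) = a \<times> b"
      using sets.sets_into_space[OF \<open>a \<in> _\<close>] sets.sets_into_space[OF \<open>b \<in> _\<close>]
      by (auto simp: space_restrict_space)
    finally show "a \<times> b \<in> sets (borel_of (X \<times> X))" .
  qed
  obtain D where D: "countable D" "D \<subseteq> X" "\<And>x e. x \<in> X \<Longrightarrow> 0 < e \<Longrightarrow> \<exists>y\<in>D. dist x y < e"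
    using compact_separable[OF assms] by blast
  define b where "b = (\<lambda>(x::'a, n). X \<inter> ball x (inverse (Suc n)))"
  have b: "b i \<in> sets (borel_of X)" for i
    by (cases i) (auto simp: b_def sets_restrict_space)
  show "sets (borel_of (X \<times> X)) \<subseteq> sets ?N"
  proof (rule sets_borel_of_subset)
    fix S :: "('a \<times> 'a) set" assume S: "open S"
    \<comment> \<open>The basic boxes contained in \<open>S\<close>. There are countably many, and
      each point of \<open>S\<close> in the square lies in one, since \<open>S\<close> contains a
      product neighbourhood of it whose sides can be shrunk to basic balls.\<close>
    define I where "I = {(i, j) \<in> (D \<times> (UNIV::nat set)) \<times> (D \<times> (UNIV::nat set)). b i \<times> b j \<subseteq> S}"
    have "countable I"
    proof (rule countable_subset)
      show "countable ((D \<times> (UNIV::nat set)) \<times> (D \<times> (UNIV::nat set)))"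
        using D(1) by (intro countable_SIGMA) auto
    qed (auto simp: I_def)
    moreover have "b (fst q) \<times> b (snd q) \<in> sets ?N" for q
      using b by auto
    ultimately have "(\<Union>q\<in>I. b (fst q) \<times> b (snd q)) \<in> sets ?N"
      by (intro sets.countable_UN') auto
    also have "(\<Union>q\<in>I. b (fst q) \<times> b (snd q)) = S \<inter> (X \<times> X)"
    proof (intro equalityI subsetI)
      fix z assume "z \<in> (\<Union>q\<in>I. b (fst q) \<times> b (snd q))"
      then show "z \<in> S \<inter> (X \<times> X)"
        by (auto simp: I_def b_def)
    next
      fix z assume "z \<in> S \<inter> (X \<times> X)"
      then have z: "z \<in> S" "fst z \<in> X" "snd z \<in> X"
        by auto
      obtain A B where AB: "open A" "open B" "z \<in> A \<times> B" "A \<times> B \<subseteq> S"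
        using S z(1) by (rule open_prod_elim)
      obtain e1 where e1: "0 < e1" "ball (fst z) e1 \<subseteq> A"
        using AB by (metis mem_Times_iff open_contains_ball)
      obtain e2 where e2: "0 < e2" "ball (snd z) e2 \<subseteq> B"
        using AB by (metis mem_Times_iff open_contains_ball)
      obtain x n where xn: "x \<in> D" "fst z \<in> ball x (inverse (Suc n))"
          "ball x (inverse (Suc n)) \<subseteq> ball (fst z) e1"
        using dense_ball_refinement[OF D(3) z(2) e1(1)] by blast
      obtain y m where ym: "y \<in> D" "snd z \<in> ball y (inverse (Suc m))"
          "ball y (inverse (Suc m)) \<subseteq> ball (snd z) e2"
        using dense_ball_refinement[OF D(3) z(3) e2(1)] by blast
      have "b (x, n) \<subseteq> A" "b (y, m) \<subseteq> B"
        using xn(3) ym(3) e1(2) e2(2) by (auto simp: b_def)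
      then have "b (x, n) \<times> b (y, m) \<subseteq> S"
        using AB(4) Sigma_mono by blast
      then have "((x, n), (y, m)) \<in> I"
        using xn(1) ym(1) by (simp add: I_def)
      moreover have "z \<in> b (x, n) \<times> b (y, m)"
        using xn ym z by (auto simp: b_def mem_Times_iff)
      ultimately show "z \<in> (\<Union>q\<in>I. b (fst q) \<times> b (snd q))"
        by (intro UN_I[of "((x, n), (y, m))"]) auto
    qed
    finally show "S \<inter> (X \<times> X) \<in> sets ?N" .
  qed (simp add: space_pair_measure space_restrict_space)
qed

section \<open>Transport costs and the construction of couplings\<close>

lemma transport_cost_measurable:
  fixes X :: "'a::metric_space set"
  assumes "sets \<pi> = sets (borel_of (X \<times> X))"
  shows "(\<lambda>z. dist (fst z) (snd z) powr p) \<in> borel_measurable \<pi>"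
proof -
  have "(\<lambda>z. dist (fst z) (snd z)) \<in> borel_measurable (borel_of (X \<times> X))"
    by (intro borel_measurable_continuous_on_restrict continuous_intros)
  then have "(\<lambda>z. dist (fst z) (snd z)) \<in> borel_measurable \<pi>"
    using assms by (simp cong: measurable_cong_sets)
  then show ?thesis by measurable
qed

lemma transport_cost_integrable:
  fixes X :: "'a::metric_space set"
  assumes X: "compact X" and \<pi>: "\<pi> \<in> borel_probs (X \<times> X)" and p: "0 \<le> p"
  shows "integrable \<pi> (\<lambda>z. dist (fst z) (snd z) powr p)"
proof -
  interpret prob_space \<pi> using borel_probsD[OF \<pi>] by simp
  have "bounded X" using X by (rule compact_imp_bounded)
  then obtain C where C: "\<forall>x\<in>X. \<forall>y\<in>X. dist x y \<le> C" by (auto simp: bounded_two_points)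
  show ?thesis
  proof (rule integrable_const_bound[where B = "C powr p"])
    show "AE z in \<pi>. norm (dist (fst z) (snd z) powr p) \<le> C powr p"
      using borel_probsD(3)[OF \<pi>] C p by (intro AE_I2) (auto intro!: powr_mono2)
    show "(\<lambda>z. dist (fst z) (snd z) powr p) \<in> borel_measurable \<pi>"
      by (rule transport_cost_measurable) (rule borel_probsD[OF \<pi>])
  qed
qed

text \<open>The passage between real costs and nonnegative integrals: changes of variables and
  Tonelli are carried out on the right-hand side, and the result is read off for real
  numbers.\<close>

lemma ennreal_transport_cost:
  fixes X :: "'a::metric_space set"
  assumes "compact X" and "\<pi> \<in> borel_probs (X \<times> X)" and "0 \<le> p"
  shows "ennreal (transport_cost p \<pi>) = (\<integral>\<^sup>+z. ennreal (dist (fst z) (snd z) powr p) \<partial>\<pi>)"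
  using transport_cost_integrable[OF assms] by (subst nn_integral_eq_integral) auto

lemma couplingsD:
  assumes "\<pi> \<in> couplings X \<mu> \<nu>"
  shows "\<pi> \<in> borel_probs (X \<times> X)" "distr \<pi> (borel_of X) fst = \<mu>" "distr \<pi> (borel_of X) snd = \<nu>"
    "fst \<in> measurable \<pi> (borel_of X)" "snd \<in> measurable \<pi> (borel_of X)"
proof -
  show \<pi>: "\<pi> \<in> borel_probs (X \<times> X)" and "distr \<pi> (borel_of X) fst = \<mu>" "distr \<pi> (borel_of X) snd = \<nu>"
    using assms by (auto simp: couplings_def)
  show "fst \<in> measurable \<pi> (borel_of X)" "snd \<in> measurable \<pi> (borel_of X)"
    using measurable_fst_borel_of[of X X] measurable_snd_borel_of[of X X] borel_probsD(2)[OF \<pi>]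
    by (simp_all cong: measurable_cong_sets)
qed

lemma distr_borel_of:
  assumes "prob_space M" and "f \<in> measurable M (borel_of X)"
  shows "distr M (borel_of X) f \<in> borel_probs X"
  using prob_space.prob_space_distr[OF assms] by (simp add: borel_probs_def)

lemma couplings_marginals:
  assumes "\<pi> \<in> couplings X \<mu> \<nu>"
  shows "\<mu> \<in> borel_probs X" "\<nu> \<in> borel_probs X"
  using distr_borel_of[OF borel_probsD(1)[OF couplingsD(1)[OF assms]]] couplingsD(2-5)[OF assms]
  by metis+

text \<open>The source of every explicit coupling below: the joint law of two
  \<open>X\<close>-valued random variables on a common probability space. The cost formula is the
  change of variables.\<close>

lemma distr_Pair_coupling:
  fixes X :: "'a::metric_space set"
  assumes X: "compact X" and M: "prob_space M"
    and f: "f \<in> measurable M (borel_of X)" and g: "g \<in> measurable M (borel_of X)"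
  defines "\<pi> \<equiv> distr M (borel_of (X \<times> X)) (\<lambda>w. (f w, g w))"
  shows "\<pi> \<in> couplings X (distr M (borel_of X) f) (distr M (borel_of X) g)"
    and "0 \<le> p \<Longrightarrow> ennreal (transport_cost p \<pi>) = (\<integral>\<^sup>+w. ennreal (dist (f w) (g w) powr p) \<partial>M)"
proof -
  have fg: "(\<lambda>w. (f w, g w)) \<in> measurable M (borel_of (X \<times> X))"
    using measurable_Pair[OF f g] sets_borel_of_Times[OF X] by (simp cong: measurable_cong_sets)
  have \<pi>: "\<pi> \<in> borel_probs (X \<times> X)"
    unfolding \<pi>_def using M fg by (rule distr_borel_of)
  show "\<pi> \<in> couplings X (distr M (borel_of X) f) (distr M (borel_of X) g)"
    using \<pi> by (auto simp: couplings_def \<pi>_def comp_def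
        distr_distr[OF measurable_fst_borel_of fg] distr_distr[OF measurable_snd_borel_of fg])
  assume p: "0 \<le> p"
  have "ennreal (transport_cost p \<pi>) = (\<integral>\<^sup>+z. ennreal (dist (fst z) (snd z) powr p) \<partial>\<pi>)"
    by (rule ennreal_transport_cost) fact+
  also have "\<dots> = (\<integral>\<^sup>+w. ennreal (dist (f w) (g w) powr p) \<partial>M)"
    unfolding \<pi>_def
    by (subst nn_integral_distr[OF fg])
      (auto intro!: measurable_compose[OF transport_cost_measurable])
  finally show "ennreal (transport_cost p \<pi>) = (\<integral>\<^sup>+w. ennreal (dist (f w) (g w) powr p) \<partial>M)" .
qed

text \<open>The two coordinates under the product measure form the coupling. It ensures that the
  infimum of the costs is taken over a nonempty set and hence respects lower bounds.\<close>

lemma couplings_nonempty: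
  fixes X :: "'a::metric_space set"
  assumes X: "compact X" and \<mu>: "\<mu> \<in> borel_probs X" and \<nu>: "\<nu> \<in> borel_probs X"
  shows "couplings X \<mu> \<nu> \<noteq> {}"
proof -
  note M = borel_probsD[OF \<mu>] and N = borel_probsD[OF \<nu>]
  interpret M: prob_space \<mu> by (rule M)
  interpret N: prob_space \<nu> by (rule N)
  have f: "fst \<in> measurable (\<mu> \<Otimes>\<^sub>M \<nu>) (borel_of X)" and g: "snd \<in> measurable (\<mu> \<Otimes>\<^sub>M \<nu>) (borel_of X)"
    using measurable_fst[of \<mu> \<nu>] measurable_snd[of \<mu> \<nu>] M(2) N(2) by (simp_all cong: measurable_cong_sets)
  have "distr (\<mu> \<Otimes>\<^sub>M \<nu>) (borel_of X) fst = distr (\<mu> \<Otimes>\<^sub>M \<nu>) \<mu> fst"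
    using M(2) by (intro distr_cong) auto
  also have "\<dots> = \<mu>" by (rule N.distr_pair_fst)
  finally have 1: "distr (\<mu> \<Otimes>\<^sub>M \<nu>) (borel_of X) fst = \<mu>" .
  have "distr (\<mu> \<Otimes>\<^sub>M \<nu>) (borel_of X) snd = \<nu>"
  proof (rule measure_eqI)
    fix A assume A: "A \<in> sets (distr (\<mu> \<Otimes>\<^sub>M \<nu>) (borel_of X) snd)"
    then have "A \<in> sets \<nu>" using N(2) by simp
    have "emeasure (distr (\<mu> \<Otimes>\<^sub>M \<nu>) (borel_of X) snd) A = emeasure (\<mu> \<Otimes>\<^sub>M \<nu>) (space \<mu> \<times> A)"
      using A sets.sets_into_space[OF \<open>A \<in> sets \<nu>\<close>]
      by (subst emeasure_distr[OF g]) (auto intro!: arg_cong2[where f = emeasure] simp: space_pair_measure)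
    also have "\<dots> = emeasure \<nu> A"
      using \<open>A \<in> sets \<nu>\<close> by (simp add: N.emeasure_pair_measure_Times M.emeasure_space_1)
    finally show "emeasure (distr (\<mu> \<Otimes>\<^sub>M \<nu>) (borel_of X) snd) A = emeasure \<nu> A" .
  qed (simp add: N(2))
  moreover have "prob_space (\<mu> \<Otimes>\<^sub>M \<nu>)" by (rule prob_space_pair[OF M(1) N(1)])
  ultimately show ?thesis using distr_Pair_coupling(1)[OF X _ f g] 1 by auto
qed

section \<open>Elementary properties of the Wasserstein distance\<close>

lemma wasserstein_eq:
  "wasserstein X p \<mu> \<nu> = (INF \<pi>\<in>couplings X \<mu> \<nu>. transport_cost p \<pi>) powr (1 / p)"
  by (simp add: wasserstein_def case_prod_unfold)

lemma INF_transport_cost_le: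
  assumes "\<pi> \<in> couplings X \<mu> \<nu>"
  shows "(INF \<pi>\<in>couplings X \<mu> \<nu>. transport_cost p \<pi>) \<le> transport_cost p \<pi>"
  using assms by (intro cINF_lower bdd_belowI2[of _ 0]) auto

lemma INF_transport_cost_greatest:
  fixes X :: "'a::metric_space set"
  assumes "compact X" "\<mu> \<in> borel_probs X" "\<nu> \<in> borel_probs X"
    and "\<And>\<pi>. \<pi> \<in> couplings X \<mu> \<nu> \<Longrightarrow> c \<le> transport_cost p \<pi>"
  shows "c \<le> (INF \<pi>\<in>couplings X \<mu> \<nu>. transport_cost p \<pi>)"
  using couplings_nonempty[OF assms(1-3)] assms(4) by (rule cINF_greatest)

lemma INF_transport_cost_nonneg:
  fixes X :: "'a::metric_space set"
  assumes "compact X" "\<mu> \<in> borel_probs X" "\<nu> \<in> borel_probs X"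
  shows "0 \<le> (INF \<pi>\<in>couplings X \<mu> \<nu>. transport_cost p \<pi>)"
  using assms by (rule INF_transport_cost_greatest) simp

text \<open>Estimates are made for the \<open>p\<close>-th power, which is a plain infimum of costs
  and so scales linearly with them.\<close>

lemma wasserstein_powr:
  fixes X :: "'a::metric_space set"
  assumes "compact X" "\<mu> \<in> borel_probs X" "\<nu> \<in> borel_probs X" "p > 0"
  shows "wasserstein X p \<mu> \<nu> powr p = (INF \<pi>\<in>couplings X \<mu> \<nu>. transport_cost p \<pi>)"
  using INF_transport_cost_nonneg[OF assms(1-3)] assms(4) by (simp add: wasserstein_eq powr_powr)

lemma transport_cost_swap:
  fixes X :: "'a::metric_space set"
  assumes X: "compact X" and \<pi>: "\<pi> \<in> couplings X \<mu> \<nu>" and p: "0 \<le> p"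
  shows "\<exists>\<sigma>\<in>couplings X \<nu> \<mu>. transport_cost p \<sigma> = transport_cost p \<pi>"
proof -
  note C = couplingsD[OF \<pi>] and P = distr_Pair_coupling[OF X borel_probsD(1)[OF couplingsD(1)[OF \<pi>]] couplingsD(5,4)[OF \<pi>]]
  let ?\<sigma> = "distr \<pi> (borel_of (X \<times> X)) (\<lambda>w. (snd w, fst w))"
  have "ennreal (transport_cost p ?\<sigma>) = ennreal (transport_cost p \<pi>)"
    using P(2)[OF p] ennreal_transport_cost[OF X C(1) p] by (simp add: dist_commute)
  then have "transport_cost p ?\<sigma> = transport_cost p \<pi>" by (subst (asm) ennreal_inj) auto
  then show ?thesis using P(1) C(2,3) by blast
qed

text \<open>Exchanging the coordinates shows that each cost for one order of the measures is a cost
  for the other, so both infima are over the same set of numbers.\<close>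

lemma wasserstein_commute:
  fixes X :: "'a::metric_space set"
  assumes X: "compact X" and p: "0 \<le> p"
  shows "wasserstein X p \<mu> \<nu> = wasserstein X p \<nu> \<mu>"
proof -
  have sub: "transport_cost p ` couplings X \<mu> \<nu> \<subseteq> transport_cost p ` couplings X \<nu> \<mu>" for \<mu> \<nu>
  proof
    fix c assume "c \<in> transport_cost p ` couplings X \<mu> \<nu>"
    then obtain \<pi> where \<pi>: "\<pi> \<in> couplings X \<mu> \<nu>" "c = transport_cost p \<pi>" by (rule imageE)
    obtain \<sigma> where "\<sigma> \<in> couplings X \<nu> \<mu>" "transport_cost p \<sigma> = transport_cost p \<pi>"
      using transport_cost_swap[OF X \<pi>(1) p] by (rule bexE)
    then show "c \<in> transport_cost p ` couplings X \<nu> \<mu>" using \<pi>(2) by (intro image_eqI[of _ _ \<sigma>]) simp_all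
  qed
  have "transport_cost p ` couplings X \<mu> \<nu> = transport_cost p ` couplings X \<nu> \<mu>"
    by (rule antisym[OF sub sub])
  then show ?thesis by (simp add: wasserstein_eq)
qed

lemma wasserstein_self:
  fixes X :: "'a::metric_space set"
  assumes X: "compact X" and \<mu>: "\<mu> \<in> borel_probs X" and p: "0 < p"
  shows "wasserstein X p \<mu> \<mu> = 0"
proof -
  have id: "(\<lambda>x. x) \<in> measurable \<mu> (borel_of X)"
    using borel_probsD(2)[OF \<mu>] by (simp add: measurable_ident_sets)
  note P = distr_Pair_coupling[OF X borel_probsD(1)[OF \<mu>] id id]
  \<comment> \<open>The diagonal coupling, under which no mass moves.\<close>
  let ?\<sigma> = "distr \<mu> (borel_of (X \<times> X)) (\<lambda>w. (w, w))"
  have "distr \<mu> (borel_of X) (\<lambda>x. x) = \<mu>"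
    using borel_probsD(2)[OF \<mu>] by (intro distr_id2) simp
  then have \<sigma>: "?\<sigma> \<in> couplings X \<mu> \<mu>" using P(1) by simp
  have "ennreal (transport_cost p ?\<sigma>) = 0" using P(2)[of p] p by simp
  then have "transport_cost p ?\<sigma> \<le> 0" by (simp only: ennreal_eq_0_iff)
  then have "(INF \<pi>\<in>couplings X \<mu> \<mu>. transport_cost p \<pi>) = 0"
    using INF_transport_cost_le[OF \<sigma>, of p] INF_transport_cost_nonneg[OF X \<mu> \<mu>, of p] by linarith
  then show ?thesis by (simp add: wasserstein_eq)
qed

section \<open>Linear interpolation of measures\<close>

text \<open>Written as a law instead of as a mixture, so that the measures at all times come from
  random variables on one probability space and are coupled without further work. The dependence on
  the coupling \<open>\<pi>\<close> is only apparent, by \<open>interpolate_cong\<close>.\<close>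

definition interpolate ::
  "'a::topological_space set \<Rightarrow> ('a \<times> 'a) measure \<Rightarrow> real \<Rightarrow> 'a measure" where
  "interpolate X \<pi> t = distr (uniform_measure lborel {0..1::real} \<Otimes>\<^sub>M \<pi>) (borel_of X)
     (\<lambda>w. if fst w < t then snd (snd w) else fst (snd w))"

lemma interpolate_measurable:
  assumes "\<pi> \<in> couplings X \<mu> \<nu>"
  shows "(\<lambda>w. if fst w < t then snd (snd w) else fst (snd w))
    \<in> measurable (uniform_measure lborel {0..1::real} \<Otimes>\<^sub>M \<pi>) (borel_of X)"
proof -
  note [measurable] = couplingsD(4,5)[OF assms]
  show ?thesis by measurable
qed

lemma uniform_01:
  shows "prob_space (uniform_measure lborel {0..1::real})"
    and "0 \<le> a \<Longrightarrow> a \<le> b \<Longrightarrow> b \<le> 1 \<Longrightarrow> emeasure (uniform_measure lborel {0..1::real}) {a..<b} = ennreal (b - a)"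
proof -
  show "prob_space (uniform_measure lborel {0..1::real})"
    by (rule prob_space_uniform_measure) auto
  assume "0 \<le> a" "a \<le> b" "b \<le> 1"
  then show "emeasure (uniform_measure lborel {0..1::real}) {a..<b} = ennreal (b - a)"
    by (subst emeasure_uniform_measure) (auto simp: Int_absorb1 atLeastLessThan_subseteq_atLeastAtMost_iff divide_ennreal_def)
qed

text \<open>According to whether the uniform variable is below \<open>t\<close>, the preimage of
  \<open>A\<close> is a disjoint union of two boxes, and independence factors the mass of
  each.\<close>

lemma emeasure_interpolate:
  assumes \<pi>: "\<pi> \<in> couplings X \<mu> \<nu>" and t: "t \<in> {0..1}" and A: "A \<in> sets (borel_of X)"
  shows "emeasure (interpolate X \<pi> t) A = ennreal t * emeasure \<nu> A + ennreal (1 - t) * emeasure \<mu> A"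
proof -
  let ?U = "uniform_measure lborel {0..1::real}"
  note C = couplingsD[OF \<pi>]
  interpret U: prob_space ?U by (rule uniform_01)
  interpret P: prob_space \<pi> by (rule borel_probsD[OF C(1)])
  let ?A = "fst -` A \<inter> space \<pi>" and ?B = "snd -` A \<inter> space \<pi>"
  have AB: "?A \<in> sets \<pi>" "?B \<in> sets \<pi>"
    using C A by auto
  have le: "emeasure ?U {..<t} = ennreal t" "emeasure ?U {t..} = ennreal (1 - t)"
  proof -
    have "{0..1} \<inter> {..<t} = {0..<t}" "{0..1} \<inter> {t..} = {t..1}" using t by auto
    then show "emeasure ?U {..<t} = ennreal t" "emeasure ?U {t..} = ennreal (1 - t)"
      using t by (subst emeasure_uniform_measure; simp add: divide_ennreal_def)+
  qed
  have "emeasure (interpolate X \<pi> t) A = emeasure (?U \<Otimes>\<^sub>M \<pi>)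
      ((\<lambda>w. if fst w < t then snd (snd w) else fst (snd w)) -` A \<inter> space (?U \<Otimes>\<^sub>M \<pi>))"
    unfolding interpolate_def by (rule emeasure_distr[OF interpolate_measurable[OF \<pi>] A])
  also have "(\<lambda>w. if fst w < t then snd (snd w) else fst (snd w)) -` A \<inter> space (?U \<Otimes>\<^sub>M \<pi>)
      = {..<t} \<times> ?B \<union> {t..} \<times> ?A"
    by (auto simp: space_pair_measure split: if_splits)
  also have "emeasure (?U \<Otimes>\<^sub>M \<pi>) \<dots> = emeasure (?U \<Otimes>\<^sub>M \<pi>) ({..<t} \<times> ?B) + emeasure (?U \<Otimes>\<^sub>M \<pi>) ({t..} \<times> ?A)"
    using AB by (intro plus_emeasure[symmetric]) auto
  also have "\<dots> = ennreal t * emeasure \<pi> ?B + ennreal (1 - t) * emeasure \<pi> ?A"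
    using AB le by (simp add: P.emeasure_pair_measure_Times)
  also have "emeasure \<pi> ?B = emeasure \<nu> A"
    unfolding C(3)[symmetric] using C(5) A by (rule emeasure_distr[symmetric])
  also have "emeasure \<pi> ?A = emeasure \<mu> A"
    unfolding C(2)[symmetric] using C(4) A by (rule emeasure_distr[symmetric])
  finally show ?thesis .
qed

lemma interpolate_in_borel_probs:
  assumes \<pi>: "\<pi> \<in> couplings X \<mu> \<nu>"
  shows "interpolate X \<pi> t \<in> borel_probs X"
  unfolding interpolate_def
  by (rule distr_borel_of[OF prob_space_pair[OF uniform_01(1) borel_probsD(1)[OF couplingsD(1)[OF \<pi>]]]
        interpolate_measurable[OF \<pi>]])

text \<open>The mixture formula involves the marginals alone. Hence one fixed path can be estimated
  with every coupling of its endpoints, and the estimates survive passing to the infimum.\<close>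

lemma interpolate_cong:
  assumes "\<pi> \<in> couplings X \<mu> \<nu>" "\<sigma> \<in> couplings X \<mu> \<nu>" "t \<in> {0..1}"
  shows "interpolate X \<pi> t = interpolate X \<sigma> t"
proof (rule measure_eqI)
  show "sets (interpolate X \<pi> t) = sets (interpolate X \<sigma> t)" by (simp add: interpolate_def)
  fix A assume "A \<in> sets (interpolate X \<pi> t)"
  then show "emeasure (interpolate X \<pi> t) A = emeasure (interpolate X \<sigma> t) A"
    using emeasure_interpolate[OF assms(1,3)] emeasure_interpolate[OF assms(2,3)]
    by (simp add: interpolate_def)
qed

lemma interpolate_endpoints:
  assumes \<pi>: "\<pi> \<in> couplings X \<mu> \<nu>"
  shows "interpolate X \<pi> 0 = \<mu>" "interpolate X \<pi> 1 = \<nu>"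
proof -
  note M = borel_probsD[OF couplings_marginals(1)[OF \<pi>]] and N = borel_probsD[OF couplings_marginals(2)[OF \<pi>]]
  show "interpolate X \<pi> 0 = \<mu>"
    by (rule measure_eqI) (simp_all add: interpolate_def[where t = 0] M(2) emeasure_interpolate[OF \<pi>, of 0, unfolded interpolate_def])
  show "interpolate X \<pi> 1 = \<nu>"
    by (rule measure_eqI) (simp_all add: interpolate_def[where t = 1] N(2) emeasure_interpolate[OF \<pi>, of 1, unfolded interpolate_def])
qed

lemma transport_cost_interpolate:
  fixes X :: "'a::metric_space set"
  assumes X: "compact X" and \<pi>: "\<pi> \<in> couplings X \<mu> \<nu>" and p: "0 < p"
    and st: "0 \<le> s" "s \<le> t" "t \<le> 1"
  shows "\<exists>\<sigma>\<in>couplings X (interpolate X \<pi> s) (interpolate X \<pi> t).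
    transport_cost p \<sigma> = (t - s) * transport_cost p \<pi>"
proof -
  let ?U = "uniform_measure lborel {0..1::real}"
  let ?f = "\<lambda>t w. if fst w < t then snd (snd w) else fst (snd w)"
  note C = couplingsD[OF \<pi>]
  interpret U: prob_space ?U by (rule uniform_01)
  interpret P: prob_space \<pi> by (rule borel_probsD[OF C(1)])
  interpret UP: pair_sigma_finite ?U \<pi> ..
  note D = distr_Pair_coupling[OF X prob_space_pair[OF uniform_01(1) P.prob_space_axioms]
     interpolate_measurable[OF \<pi>, of s] interpolate_measurable[OF \<pi>, of t]]
  let ?\<sigma> = "distr (?U \<Otimes>\<^sub>M \<pi>) (borel_of (X \<times> X)) (\<lambda>w. (?f s w, ?f t w))"
  note [measurable] = transport_cost_measurable[OF borel_probsD(2)[OF C(1)], of p]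
  have "ennreal (transport_cost p ?\<sigma>) = (\<integral>\<^sup>+w. ennreal (dist (?f s w) (?f t w) powr p) \<partial>(?U \<Otimes>\<^sub>M \<pi>))"
    using D(2) p by simp
  \<comment> \<open>The two variables differ in their choice of coordinate only when the uniform
    variable lies in \<open>{s..<t}\<close>: then time \<open>s\<close> still picks the first
    coordinate and time \<open>t\<close> already the second. Outside this interval the cost
    vanishes.\<close>
  also have "\<dots> = (\<integral>\<^sup>+w. indicator {s..<t} (fst w) * ennreal (dist (fst (snd w)) (snd (snd w)) powr p) \<partial>(?U \<Otimes>\<^sub>M \<pi>))"
    using st p by (intro nn_integral_cong) (auto simp: indicator_def)
  also have "\<dots> = (\<integral>\<^sup>+u. \<integral>\<^sup>+z. indicator {s..<t} u * ennreal (dist (fst z) (snd z) powr p) \<partial>\<pi> \<partial>?U)"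
    by (subst P.nn_integral_fst[symmetric]) auto
  also have "\<dots> = (\<integral>\<^sup>+u. indicator {s..<t} u * ennreal (transport_cost p \<pi>) \<partial>?U)"
    using p by (simp add: nn_integral_cmult ennreal_transport_cost[OF X C(1)])
  also have "\<dots> = emeasure ?U {s..<t} * ennreal (transport_cost p \<pi>)"
    by (subst nn_integral_multc) auto
  also have "\<dots> = ennreal ((t - s) * transport_cost p \<pi>)"
    using st uniform_01(2)[of s t] by (simp add: ennreal_mult)
  finally have "transport_cost p ?\<sigma> = (t - s) * transport_cost p \<pi>"
    using st by (subst (asm) ennreal_inj) auto
  then show ?thesis using D(1) unfolding interpolate_def by blast
qed

lemma wasserstein_interpolate_powr_le:
  fixes X :: "'a::metric_space set"
  assumes X: "compact X" and \<pi>: "\<pi> \<in> couplings X \<mu> \<nu>" and p: "0 < p"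
    and st: "s \<in> {0..1}" "t \<in> {0..1}"
  shows "wasserstein X p (interpolate X \<pi> s) (interpolate X \<pi> t) powr p
    \<le> \<bar>s - t\<bar> * wasserstein X p \<mu> \<nu> powr p"
proof -
  note I = interpolate_in_borel_probs[OF \<pi>] and M = couplings_marginals[OF \<pi>]
  have *: "wasserstein X p (interpolate X \<pi> s) (interpolate X \<pi> t) powr p
    \<le> (t - s) * wasserstein X p \<mu> \<nu> powr p" if st: "0 \<le> s" "s < t" "t \<le> 1" for s t
  proof -
    let ?W = "wasserstein X p (interpolate X \<pi> s) (interpolate X \<pi> t) powr p"
    \<comment> \<open>Dividing by the positive number \<open>t - s\<close> isolates a lower bound
      for the cost of every coupling of the endpoints, hence for their infimum. Equal times are
      treated separately below.\<close>
    have "?W / (t - s) \<le> transport_cost p \<rho>" if \<rho>: "\<rho> \<in> couplings X \<mu> \<nu>" for \<rho>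
    proof -
      have "interpolate X \<rho> s = interpolate X \<pi> s" "interpolate X \<rho> t = interpolate X \<pi> t"
        using interpolate_cong[OF \<rho> \<pi>] st by auto
      then obtain \<sigma> where \<sigma>: "\<sigma> \<in> couplings X (interpolate X \<pi> s) (interpolate X \<pi> t)"
          "transport_cost p \<sigma> = (t - s) * transport_cost p \<rho>"
        using transport_cost_interpolate[OF X \<rho> p, of s t] st by auto
      have "?W \<le> (t - s) * transport_cost p \<rho>"
        using INF_transport_cost_le[OF \<sigma>(1), of p] \<sigma>(2) wasserstein_powr[OF X I I p] by simp
      then show ?thesis using st by (simp add: field_simps)
    qed
    then have "?W / (t - s) \<le> wasserstein X p \<mu> \<nu> powr p"
      unfolding wasserstein_powr[OF X M p] by (rule INF_transport_cost_greatest[OF X M])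
    then show ?thesis using st by (simp add: field_simps)
  qed
  consider "s < t" | "s = t" | "t < s" by linarith
  then show ?thesis
  proof cases
    case 1
    then show ?thesis using *[of s t] st by simp
  next
    case 2
    then show ?thesis using wasserstein_self[OF X I p] p by simp
  next
    case 3
    then show ?thesis using *[of t s] st p
      by (simp add: wasserstein_commute[OF X, of p "interpolate X \<pi> s"])
  qed
qed

section \<open>Approximate gluing of couplings and the triangle inequality\<close>

lemma AE_fibre_pos:
  fixes k :: "'b \<Rightarrow> nat"
  assumes M: "prob_space M" and [measurable]: "k \<in> measurable M (count_space UNIV)"
  shows "AE z in M. 0 < measure M (k -` {k z} \<inter> space M)"
proof -
  interpret prob_space M by fact
  \<comment> \<open>A fibre without mass is a null set, and there are only countably many fibres.
    Almost surely, therefore, the denominator in \<open>fibre_weight\<close> is positive.\<close>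
  have "AE z in M. measure M (k -` {i} \<inter> space M) = 0 \<longrightarrow> k z \<noteq> i" for i
  proof (cases "measure M (k -` {i} \<inter> space M) = 0")
    case True
    moreover have "k -` {i} \<inter> space M \<in> sets M" by measurable
    ultimately have "k -` {i} \<inter> space M \<in> null_sets M"
      by (simp add: null_sets_def emeasure_eq_measure)
    from AE_not_in[OF this] show ?thesis using AE_space by eventually_elim auto
  qed simp
  then have "AE z in M. \<forall>i. measure M (k -` {i} \<inter> space M) = 0 \<longrightarrow> k z \<noteq> i"
    by (simp add: AE_all_countable)
  then show ?thesis
    by eventually_elim (use zero_less_measure_iff in blast)
qed

text \<open>
  Two random variables with discrete laws that agree are made equal by reweighting the product
  measure; this replaces the disintegration of the usual gluing lemma.
\<close>

definition fibre_weight :: "'b measure \<Rightarrow> ('b \<Rightarrow> nat) \<Rightarrow> ('c \<Rightarrow> nat) \<Rightarrow> 'b \<times> 'c \<Rightarrow> ennreal" where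
  "fibre_weight M k l w = ennreal
     (if k (fst w) = l (snd w) then 1 / measure M (k -` {k (fst w)} \<inter> space M) else 0)"

lemma fibre_weight_measurable:
  assumes [measurable]: "k \<in> measurable M (count_space UNIV)" "l \<in> measurable N (count_space UNIV)"
  shows "fibre_weight M k l \<in> borel_measurable (M \<Otimes>\<^sub>M N)"
proof -
  \<comment> \<open>The value \<open>i\<close> of \<open>k\<close> is frozen first; measurability
    for each \<open>i\<close> suffices because \<open>k\<close> has countably many values.\<close>
  have "(\<lambda>w. (\<lambda>i w. ennreal (if i = l (snd w) then 1 / measure M (k -` {i} \<inter> space M) else 0)) (k (fst w)) w)
    \<in> borel_measurable (M \<Otimes>\<^sub>M N)"
    by (rule measurable_compose_countable) measurable
  then show ?thesis by (simp add: fibre_weight_def[abs_def])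
qed

lemma nn_integral_fibre:
  fixes k :: "'b \<Rightarrow> nat"
  assumes M: "prob_space M" and [measurable]: "k \<in> measurable M (count_space UNIV)"
    and m: "measure M (k -` {i} \<inter> space M) = m" "0 < m"
  shows "(\<integral>\<^sup>+z. ennreal (if k z = i then 1 / m else 0) \<partial>M) = 1"
proof -
  interpret prob_space M by fact
  have "(\<integral>\<^sup>+z. ennreal (if k z = i then 1 / m else 0) \<partial>M)
    = (\<integral>\<^sup>+z. ennreal (1 / m) * indicator (k -` {i} \<inter> space M) z \<partial>M)"
    by (intro nn_integral_cong) auto
  also have "\<dots> = ennreal (1 / m) * ennreal m"
    using m by (subst nn_integral_cmult_indicator) (auto simp: emeasure_eq_measure)
  also have "\<dots> = 1" using m(2) by (simp add: ennreal_mult[symmetric])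
  finally show ?thesis .
qed

text \<open>For almost every value of one coordinate, the weight integrates to 1 in the other, so
  the reweighted product has marginals \<open>M\<close> and \<open>N\<close>. The weight is
  normalised by masses of fibres of \<open>k\<close>; by \<open>eq\<close> these are also the masses
  of the fibres of \<open>l\<close>, which makes the second claim work like the first.\<close>

lemma nn_integral_fibre_weight:
  assumes M: "prob_space M" and N: "prob_space N"
    and k [measurable]: "k \<in> measurable M (count_space UNIV)"
    and l [measurable]: "l \<in> measurable N (count_space UNIV)"
    and eq: "\<And>i. measure N (l -` {i} \<inter> space N) = measure M (k -` {i} \<inter> space M)"
  shows "F \<in> borel_measurable M \<Longrightarrow>
      (\<integral>\<^sup>+w. fibre_weight M k l w * F (fst w) \<partial>(M \<Otimes>\<^sub>M N)) = (\<integral>\<^sup>+z. F z \<partial>M)"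
    and "G \<in> borel_measurable N \<Longrightarrow>
      (\<integral>\<^sup>+w. fibre_weight M k l w * G (snd w) \<partial>(M \<Otimes>\<^sub>M N)) = (\<integral>\<^sup>+y. G y \<partial>N)"
proof -
  interpret M: prob_space M by fact
  interpret N: prob_space N by fact
  interpret MN: pair_sigma_finite M N ..
  note [measurable] = fibre_weight_measurable[OF k l]
  {
    assume [measurable]: "F \<in> borel_measurable M"
    have "(\<integral>\<^sup>+w. fibre_weight M k l w * F (fst w) \<partial>(M \<Otimes>\<^sub>M N))
      = (\<integral>\<^sup>+z. \<integral>\<^sup>+y. fibre_weight M k l (z, y) * F z \<partial>N \<partial>M)"
      by (subst N.nn_integral_fst[symmetric]) auto
    also have "\<dots> = (\<integral>\<^sup>+z. F z \<partial>M)"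
      using AE_fibre_pos[OF M k]
    proof (intro nn_integral_cong_AE, eventually_elim)
      fix z assume "0 < measure M (k -` {k z} \<inter> space M)"
      have fw: "fibre_weight M k l (z, y)
          = ennreal (if l y = k z then 1 / measure M (k -` {k z} \<inter> space M) else 0)" for y
        by (auto simp: fibre_weight_def)
      have "(\<integral>\<^sup>+y. fibre_weight M k l (z, y) \<partial>N) = 1"
        unfolding fw by (rule nn_integral_fibre[OF N l eq]) fact
      moreover have "(\<lambda>y. fibre_weight M k l (z, y)) \<in> borel_measurable N"
        unfolding fw by measurable
      ultimately show "(\<integral>\<^sup>+y. fibre_weight M k l (z, y) * F z \<partial>N) = F z"
        by (simp add: nn_integral_multc)
    qed
    finally show "(\<integral>\<^sup>+w. fibre_weight M k l w * F (fst w) \<partial>(M \<Otimes>\<^sub>M N)) = (\<integral>\<^sup>+z. F z \<partial>M)" .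
  }
  {
    assume [measurable]: "G \<in> borel_measurable N"
    have "(\<integral>\<^sup>+w. fibre_weight M k l w * G (snd w) \<partial>(M \<Otimes>\<^sub>M N))
      = (\<integral>\<^sup>+y. \<integral>\<^sup>+z. fibre_weight M k l (z, y) * G y \<partial>M \<partial>N)"
      using MN.nn_integral_snd[of "\<lambda>w. fibre_weight M k l w * G (snd w)"] by simp
    also have "\<dots> = (\<integral>\<^sup>+y. G y \<partial>N)"
      using AE_fibre_pos[OF N l]
    proof (intro nn_integral_cong_AE, eventually_elim)
      fix y assume pos: "0 < measure N (l -` {l y} \<inter> space N)"
      have fw: "fibre_weight M k l (z, y)
          = ennreal (if k z = l y then 1 / measure N (l -` {l y} \<inter> space N) else 0)" for z
        using eq[of "l y"] by (simp add: fibre_weight_def)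
      have "(\<integral>\<^sup>+z. fibre_weight M k l (z, y) \<partial>M) = 1"
        unfolding fw using nn_integral_fibre[OF M k eq[symmetric] pos] .
      moreover have "(\<lambda>z. fibre_weight M k l (z, y)) \<in> borel_measurable M"
        unfolding fw by measurable
      ultimately show "(\<integral>\<^sup>+z. fibre_weight M k l (z, y) * G y \<partial>M) = G y"
        by (simp add: nn_integral_multc)
    qed
    finally show "(\<integral>\<^sup>+w. fibre_weight M k l w * G (snd w) \<partial>(M \<Otimes>\<^sub>M N)) = (\<integral>\<^sup>+y. G y \<partial>N)" .
  }
qed

text \<open>Each point is labelled by the first ball of radius \<open>e / 2\<close> containing it,
  along an enumeration of a dense sequence. Points with the same label share a ball, and the labels
  cut \<open>X\<close> into countably many Borel cells.\<close>

lemma compact_small_cells: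
  fixes X :: "'a::metric_space set"
  assumes "compact X" and e: "0 < e"
  obtains q :: "'a \<Rightarrow> nat" where "q \<in> measurable (borel_of X) (count_space UNIV)"
    "\<And>x y. x \<in> X \<Longrightarrow> y \<in> X \<Longrightarrow> q x = q y \<Longrightarrow> dist x y \<le> e"
proof -
  obtain D where D: "countable D" "D \<subseteq> X" "\<And>x e. x \<in> X \<Longrightarrow> 0 < e \<Longrightarrow> \<exists>y\<in>D. dist x y < e"
    using compact_separable[OF assms(1)] by blast
  define q where "q = (\<lambda>x. LEAST n. x \<in> ball (from_nat_into D n) (e / 2))"
  have q: "x \<in> ball (from_nat_into D (q x)) (e / 2)" if x: "x \<in> X" for x
  proof -
    obtain y where "y \<in> D" "dist x y < e / 2" using D(3)[OF x, of "e / 2"] e by auto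
    moreover then obtain n where "from_nat_into D n = y"
      using from_nat_into_surj[OF D(1)] by blast
    ultimately have "\<exists>n. x \<in> ball (from_nat_into D n) (e / 2)" by (auto simp: dist_commute)
    then show ?thesis unfolding q_def by (rule LeastI_ex)
  qed
  show thesis
  proof (rule that)
    have "Measurable.pred (borel_of X) (\<lambda>x. x \<in> ball (from_nat_into D n) (e / 2))" for n
      by (auto simp: pred_def space_restrict_space sets_restrict_space
          intro!: image_eqI[of _ _ "ball (from_nat_into D n) (e / 2)"])
    then show "q \<in> measurable (borel_of X) (count_space UNIV)"
      unfolding q_def by (rule measurable_Least)
    fix x y assume "x \<in> X" "y \<in> X" "q x = q y"
    then show "dist x y \<le> e"
      using q[of x] q[of y] dist_triangle_half_r[of "from_nat_into D (q x)" x e y] by auto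
  qed
qed

text \<open>Gluing up to an error: the second point of \<open>\<pi>\<close> and the first point of
  \<open>\<sigma>\<close> are only required to lie in the same cell. Then just the discrete laws of
  the cell labels have to match, and the jump inside a cell costs at most \<open>e\<close>.\<close>

lemma transport_cost_triangle:
  fixes X :: "'a::metric_space set"
  assumes X: "compact X" and \<pi>: "\<pi> \<in> couplings X \<mu> \<nu>" and \<sigma>: "\<sigma> \<in> couplings X \<nu> \<rho>" and e: "0 < e"
  shows "\<exists>\<tau>\<in>couplings X \<mu> \<rho>. transport_cost 1 \<tau> \<le> transport_cost 1 \<pi> + transport_cost 1 \<sigma> + e"
proof -
  note P = couplingsD[OF \<pi>] and S = couplingsD[OF \<sigma>]
  note P' = borel_probsD[OF P(1)] and S' = borel_probsD[OF S(1)]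
  obtain q :: "'a \<Rightarrow> nat" where q: "q \<in> measurable (borel_of X) (count_space UNIV)"
    and qe: "\<And>x y. x \<in> X \<Longrightarrow> y \<in> X \<Longrightarrow> q x = q y \<Longrightarrow> dist x y \<le> e"
    using compact_small_cells[OF X e] by blast
  define k where "k = (\<lambda>z::'a \<times> 'a. q (snd z))"
  define l where "l = (\<lambda>z::'a \<times> 'a. q (fst z))"
  have k [measurable]: "k \<in> measurable \<pi> (count_space UNIV)"
    unfolding k_def by (rule measurable_compose[OF P(5) q])
  have l [measurable]: "l \<in> measurable \<sigma> (count_space UNIV)"
    unfolding l_def by (rule measurable_compose[OF S(4) q])
  \<comment> \<open>Both sides are the mass that the common marginal \<open>\<nu>\<close> gives to
    the cell with label \<open>i\<close>.\<close>
  have eq: "measure \<sigma> (l -` {i} \<inter> space \<sigma>) = measure \<pi> (k -` {i} \<inter> space \<pi>)" for i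
  proof -
    have Q: "q -` {i} \<inter> X \<in> sets (borel_of X)"
      using measurable_sets[OF q, of "{i}"] by (simp add: space_restrict_space)
    have "measure \<sigma> (l -` {i} \<inter> space \<sigma>) = measure (distr \<sigma> (borel_of X) fst) (q -` {i} \<inter> X)"
      using S'(3) by (subst measure_distr[OF S(4) Q]) (auto intro!: arg_cong2[where f = measure] simp: l_def)
    also have "\<dots> = measure (distr \<pi> (borel_of X) snd) (q -` {i} \<inter> X)" using P(3) S(2) by simp
    also have "\<dots> = measure \<pi> (k -` {i} \<inter> space \<pi>)"
      using P'(3) by (subst measure_distr[OF P(5) Q]) (auto intro!: arg_cong2[where f = measure] simp: k_def)
    finally show ?thesis .
  qed
  let ?h = "fibre_weight \<pi> k l"
  have h [measurable]: "?h \<in> borel_measurable (\<pi> \<Otimes>\<^sub>M \<sigma>)" by (rule fibre_weight_measurable[OF k l])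
  note I = nn_integral_fibre_weight[OF P'(1) S'(1) k l eq]
  \<comment> \<open>The glued law on quadruples \<open>((a, b), (b', c))\<close>, with
    \<open>b\<close> and \<open>b'\<close> in the same cell. Its outer points \<open>a\<close> and
    \<open>c\<close> have laws \<open>\<mu>\<close> and \<open>\<rho>\<close> and give the coupling
    sought.\<close>
  define M where "M = density (\<pi> \<Otimes>\<^sub>M \<sigma>) ?h"
  have sM [measurable_cong]: "sets M = sets (\<pi> \<Otimes>\<^sub>M \<sigma>)" by (simp add: M_def)
  have nnM: "(\<integral>\<^sup>+w. F w \<partial>M) = (\<integral>\<^sup>+w. ?h w * F w \<partial>(\<pi> \<Otimes>\<^sub>M \<sigma>))"
    if "F \<in> borel_measurable (\<pi> \<Otimes>\<^sub>M \<sigma>)" for F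
    unfolding M_def by (rule nn_integral_density[OF h that])
  have M: "prob_space M"
  proof
    have "emeasure M (space M) = (\<integral>\<^sup>+w. 1 \<partial>M)" by simp
    also have "\<dots> = (\<integral>\<^sup>+w. ?h w * 1 \<partial>(\<pi> \<Otimes>\<^sub>M \<sigma>))" by (rule nnM) simp
    also have "\<dots> = (\<integral>\<^sup>+z. 1 \<partial>\<pi>)" by (rule I(1)) simp
    also have "\<dots> = 1" using prob_space.emeasure_space_1[OF P'(1)] by simp
    finally show "emeasure M (space M) = 1" .
  qed
  note [measurable] = P(4,5) S(4,5)
  have f: "(\<lambda>w. fst (fst w)) \<in> measurable M (borel_of X)" 
    and g: "(\<lambda>w. snd (snd w)) \<in> measurable M (borel_of X)"
    using measurable_compose[OF measurable_fst P(4)] measurable_compose[OF measurable_snd S(5)]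
    by (simp_all add: sM cong: measurable_cong_sets)
  have d1: "distr M (borel_of X) (\<lambda>w. fst (fst w)) = \<mu>"
  proof (rule measure_eqI)
    fix A assume "A \<in> sets (distr M (borel_of X) (\<lambda>w. fst (fst w)))"
    then have A [measurable]: "A \<in> sets (borel_of X)" by simp
    have "emeasure (distr M (borel_of X) (\<lambda>w. fst (fst w))) A = (\<integral>\<^sup>+x. indicator A x \<partial>distr M (borel_of X) (\<lambda>w. fst (fst w)))"
      by simp
    also have "\<dots> = (\<integral>\<^sup>+w. indicator A (fst (fst w)) \<partial>M)"
      by (rule nn_integral_distr[OF f]) simp
    also have "\<dots> = (\<integral>\<^sup>+w. ?h w * indicator A (fst (fst w)) \<partial>(\<pi> \<Otimes>\<^sub>M \<sigma>))" by (rule nnM) measurable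
    also have "\<dots> = (\<integral>\<^sup>+z. indicator A (fst z) \<partial>\<pi>)"
      using I(1)[of "\<lambda>z. indicator A (fst z)"] by simp
    also have "\<dots> = (\<integral>\<^sup>+x. indicator A x \<partial>distr \<pi> (borel_of X) fst)"
      by (rule nn_integral_distr[OF P(4), symmetric]) simp
    also have "\<dots> = emeasure \<mu> A" unfolding P(2)[symmetric] by simp
    finally show "emeasure (distr M (borel_of X) (\<lambda>w. fst (fst w))) A = emeasure \<mu> A" .
  qed (simp add: P(2)[symmetric])
  have d2: "distr M (borel_of X) (\<lambda>w. snd (snd w)) = \<rho>"
  proof (rule measure_eqI)
    fix A assume "A \<in> sets (distr M (borel_of X) (\<lambda>w. snd (snd w)))"
    then have A [measurable]: "A \<in> sets (borel_of X)" by simp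
    have "emeasure (distr M (borel_of X) (\<lambda>w. snd (snd w))) A = (\<integral>\<^sup>+x. indicator A x \<partial>distr M (borel_of X) (\<lambda>w. snd (snd w)))"
      by simp
    also have "\<dots> = (\<integral>\<^sup>+w. indicator A (snd (snd w)) \<partial>M)"
      by (rule nn_integral_distr[OF g]) simp
    also have "\<dots> = (\<integral>\<^sup>+w. ?h w * indicator A (snd (snd w)) \<partial>(\<pi> \<Otimes>\<^sub>M \<sigma>))" by (rule nnM) measurable
    also have "\<dots> = (\<integral>\<^sup>+z. indicator A (snd z) \<partial>\<sigma>)"
      using I(2)[of "\<lambda>z. indicator A (snd z)"] by simp
    also have "\<dots> = (\<integral>\<^sup>+x. indicator A x \<partial>distr \<sigma> (borel_of X) snd)"
      by (rule nn_integral_distr[OF S(5), symmetric]) simp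
    also have "\<dots> = emeasure \<rho> A" unfolding S(3)[symmetric] by simp
    finally show "emeasure (distr M (borel_of X) (\<lambda>w. snd (snd w))) A = emeasure \<rho> A" .
  qed (simp add: S(3)[symmetric])
  note D = distr_Pair_coupling[OF X M f g]
  let ?\<tau> = "distr M (borel_of (X \<times> X)) (\<lambda>w. (fst (fst w), snd (snd w)))"
  have \<tau>: "?\<tau> \<in> couplings X \<mu> \<rho>" using D(1) unfolding d1 d2 .
  let ?c = "\<lambda>z::'a \<times> 'a. ennreal (dist (fst z) (snd z) powr 1)"
  have c [measurable]: "?c \<in> borel_measurable \<pi>" "?c \<in> borel_measurable \<sigma>"
    using transport_cost_measurable[OF P'(2), of 1] transport_cost_measurable[OF S'(2), of 1] by measurable
  have fg: "(\<lambda>w. (fst (fst w), snd (snd w))) \<in> measurable (\<pi> \<Otimes>\<^sub>M \<sigma>) (borel_of (X \<times> X))"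
    using measurable_Pair[OF f g] sets_borel_of_Times[OF X] sM by (simp cong: measurable_cong_sets)
  have m: "(\<lambda>w. ?h w * ?c (fst w)) \<in> borel_measurable (\<pi> \<Otimes>\<^sub>M \<sigma>)"
      "(\<lambda>w. ?h w * ?c (snd w)) \<in> borel_measurable (\<pi> \<Otimes>\<^sub>M \<sigma>)"
      "(\<lambda>w. ?h w * ennreal e) \<in> borel_measurable (\<pi> \<Otimes>\<^sub>M \<sigma>)"
    by measurable
  have "ennreal (transport_cost 1 ?\<tau>) = (\<integral>\<^sup>+w. ?c (fst (fst w), snd (snd w)) \<partial>M)"
    using D(2)[of 1] by simp
  also have "\<dots> = (\<integral>\<^sup>+w. ?h w * ?c (fst (fst w), snd (snd w)) \<partial>(\<pi> \<Otimes>\<^sub>M \<sigma>))"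
    by (rule nnM[OF measurable_compose[OF fg]]) (rule measurable_compose[OF transport_cost_measurable], auto)
  also have "\<dots> \<le> (\<integral>\<^sup>+w. ?h w * ?c (fst w) + ?h w * ?c (snd w) + ?h w * ennreal e \<partial>(\<pi> \<Otimes>\<^sub>M \<sigma>))"
  proof (rule nn_integral_mono)
    fix w assume w: "w \<in> space (\<pi> \<Otimes>\<^sub>M \<sigma>)"
    show "?h w * ?c (fst (fst w), snd (snd w)) \<le> ?h w * ?c (fst w) + ?h w * ?c (snd w) + ?h w * ennreal e"
    proof (cases "k (fst w) = l (snd w)")
      case True
      obtain a b b' c where w_eq: "w = ((a, b), (b', c))" by (metis prod.exhaust)
      \<comment> \<open>Equal labels put \<open>b\<close> and \<open>b'\<close> in one cell. In the
        remaining case the weight is 0 and the inequality is trivial.\<close>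
      have "dist b b' \<le> e"
        using w True P'(3) S'(3) by (intro qe) (auto simp: w_eq k_def l_def space_pair_measure)
      then have "dist a c \<le> dist a b + dist b' c + e"
        using dist_triangle[of a c b] dist_triangle[of b c b'] by linarith
      then have "?c (a, c) \<le> ?c (a, b) + ?c (b', c) + ennreal e"
        using e by (simp add: ennreal_plus[symmetric] del: ennreal_plus)
      then have "?h w * ?c (a, c) \<le> ?h w * (?c (a, b) + ?c (b', c) + ennreal e)"
        by (rule mult_left_mono) simp
      then show ?thesis by (simp add: w_eq distrib_left)
    qed (simp add: fibre_weight_def)
  qed
  also have "\<dots> = (\<integral>\<^sup>+w. ?h w * ?c (fst w) \<partial>(\<pi> \<Otimes>\<^sub>M \<sigma>)) + (\<integral>\<^sup>+w. ?h w * ?c (snd w) \<partial>(\<pi> \<Otimes>\<^sub>M \<sigma>))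
      + (\<integral>\<^sup>+w. ?h w * ennreal e \<partial>(\<pi> \<Otimes>\<^sub>M \<sigma>))"
    by (simp only: nn_integral_add m borel_measurable_add)
  also have "\<dots> = ennreal (transport_cost 1 \<pi>) + ennreal (transport_cost 1 \<sigma>) + ennreal e"
    using I(1)[OF c(1)] I(2)[OF c(2)] I(1)[of "\<lambda>_. ennreal e"] prob_space.emeasure_space_1[OF P'(1)]
      ennreal_transport_cost[OF X P(1), of 1] ennreal_transport_cost[OF X S(1), of 1] by simp
  also have "\<dots> = ennreal (transport_cost 1 \<pi> + transport_cost 1 \<sigma> + e)"
    using e by (simp add: ennreal_plus[symmetric] del: ennreal_plus)
  finally have "transport_cost 1 ?\<tau> \<le> transport_cost 1 \<pi> + transport_cost 1 \<sigma> + e"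
    using e by (subst (asm) ennreal_le_iff) auto
  then show ?thesis using \<tau> by blast
qed

text \<open>The error of the gluing is sent to 0 for fixed couplings; the infimum is then taken over
  \<open>\<sigma>\<close> with \<open>\<pi>\<close> fixed, and finally over
  \<open>\<pi>\<close>.\<close>

lemma wasserstein_1_triangle:
  fixes X :: "'a::metric_space set"
  assumes X: "compact X"
    and \<mu>: "\<mu> \<in> borel_probs X" and \<nu>: "\<nu> \<in> borel_probs X" and \<rho>: "\<rho> \<in> borel_probs X"
  shows "wasserstein X 1 \<mu> \<rho> \<le> wasserstein X 1 \<mu> \<nu> + wasserstein X 1 \<nu> \<rho>"
proof -
  have W: "wasserstein X 1 \<alpha> \<beta> = (INF \<pi>\<in>couplings X \<alpha> \<beta>. transport_cost 1 \<pi>)"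
    if "\<alpha> \<in> borel_probs X" "\<beta> \<in> borel_probs X" for \<alpha> \<beta>
    using INF_transport_cost_nonneg[OF X that, of 1] by (simp add: wasserstein_eq)
  have le: "wasserstein X 1 \<mu> \<rho> \<le> transport_cost 1 \<pi> + transport_cost 1 \<sigma>"
    if \<pi>: "\<pi> \<in> couplings X \<mu> \<nu>" and \<sigma>: "\<sigma> \<in> couplings X \<nu> \<rho>" for \<pi> \<sigma>
  proof (rule field_le_epsilon)
    fix e :: real assume "0 < e"
    then obtain \<tau> where "\<tau> \<in> couplings X \<mu> \<rho>"
        "transport_cost 1 \<tau> \<le> transport_cost 1 \<pi> + transport_cost 1 \<sigma> + e"
      using transport_cost_triangle[OF X \<pi> \<sigma>] by blast
    then show "wasserstein X 1 \<mu> \<rho> \<le> transport_cost 1 \<pi> + transport_cost 1 \<sigma> + e"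
      unfolding W[OF \<mu> \<rho>] using INF_transport_cost_le[of \<tau> X \<mu> \<rho> 1] by linarith
  qed
  have le': "wasserstein X 1 \<mu> \<rho> - transport_cost 1 \<pi> \<le> wasserstein X 1 \<nu> \<rho>"
    if \<pi>: "\<pi> \<in> couplings X \<mu> \<nu>" for \<pi>
    unfolding W[OF \<nu> \<rho>]
  proof (rule INF_transport_cost_greatest[OF X \<nu> \<rho>])
    fix \<sigma> assume "\<sigma> \<in> couplings X \<nu> \<rho>"
    from le[OF \<pi> this]
    show "wasserstein X 1 \<mu> \<rho> - transport_cost 1 \<pi> \<le> transport_cost 1 \<sigma>" by linarith
  qed
  have "wasserstein X 1 \<mu> \<rho> - wasserstein X 1 \<nu> \<rho> \<le> wasserstein X 1 \<mu> \<nu>"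
    unfolding W[OF \<mu> \<nu>]
  proof (rule INF_transport_cost_greatest[OF X \<mu> \<nu>])
    fix \<pi> assume "\<pi> \<in> couplings X \<mu> \<nu>"
    from le'[OF this]
    show "wasserstein X 1 \<mu> \<rho> - wasserstein X 1 \<nu> \<rho> \<le> transport_cost 1 \<pi>" by linarith
  qed
  then show ?thesis by simp
qed

section \<open>Ultrametric balls and the measures they determine\<close>

lemma ultrametric_ball_eq:
  assumes "ultrametric_on X" "x \<in> X" "y \<in> X" "y \<in> ball x r"
  shows "X \<inter> ball y r = X \<inter> ball x r"
proof -
  \<comment> \<open>The strong triangle inequality from either centre: once \<open>x\<close> and
    \<open>y\<close> are closer than \<open>r\<close>, being within \<open>r\<close> of one is the
    same as being within \<open>r\<close> of the other.\<close>
  have *: "dist x z \<le> max (dist x y) (dist y z)" "dist y z \<le> max (dist x y) (dist x z)" if "z \<in> X" for z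
    using assms that unfolding ultrametric_on_def by (metis dist_commute)+
  have "dist y z < r \<longleftrightarrow> dist x z < r" if "z \<in> X" for z
    using *[OF that] assms(4) by auto
  then show ?thesis by auto
qed

lemma ball_mass_difference_le:
  fixes X :: "'a::metric_space set"
  assumes X: "compact X" "ultrametric_on X" and \<pi>: "\<pi> \<in> couplings X \<mu> \<nu>"
    and x: "x \<in> X" and r: "0 < r" and p: "0 < p"
  shows "r powr p * \<bar>measure \<mu> (X \<inter> ball x r) - measure \<nu> (X \<inter> ball x r)\<bar> \<le> transport_cost p \<pi>"
proof -
  note C = couplingsD[OF \<pi>]
  note P = borel_probsD[OF C(1)]
  interpret prob_space \<pi> by (rule P)
  let ?B = "X \<inter> ball x r"
  have B: "?B \<in> sets (borel_of X)" by (auto simp: sets_restrict_space)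
  have S: "fst -` ?B \<inter> space \<pi> \<in> sets \<pi>" "snd -` ?B \<inter> space \<pi> \<in> sets \<pi>"
    using measurable_sets[OF C(4) B] measurable_sets[OF C(5) B] by auto
  have m: "measure \<mu> ?B = measure \<pi> (fst -` ?B \<inter> space \<pi>)" "measure \<nu> ?B = measure \<pi> (snd -` ?B \<inter> space \<pi>)"
    unfolding C(2,3)[symmetric] by (rule measure_distr[OF C(4) B] measure_distr[OF C(5) B])+
  \<comment> \<open>Its integral is the scaled difference of the two masses of the ball. It vanishes
    unless exactly one coordinate lies in the ball, which for an ultrametric forces a distance of at
    least \<open>r\<close>.\<close>
  let ?g = "\<lambda>z. r powr p * (indicator (fst -` ?B \<inter> space \<pi>) z - indicator (snd -` ?B \<inter> space \<pi>) z) :: real"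
  have i1: "integrable \<pi> (indicator (fst -` ?B \<inter> space \<pi>) :: _ \<Rightarrow> real)"
    and i2: "integrable \<pi> (indicator (snd -` ?B \<inter> space \<pi>) :: _ \<Rightarrow> real)"
    using S by (auto intro!: integrable_real_indicator simp: emeasure_eq_measure simp del: vimage_Int)
  then have i: "integrable \<pi> ?g"
    by (intro integrable_mult_right Bochner_Integration.integrable_diff)
  have g: "(\<integral>z. ?g z \<partial>\<pi>) = r powr p * (measure \<mu> ?B - measure \<nu> ?B)"
    using S by (simp add: Bochner_Integration.integral_diff[OF i1 i2] m del: vimage_Int)
  have "r powr p * \<bar>measure \<mu> ?B - measure \<nu> ?B\<bar> = \<bar>\<integral>z. ?g z \<partial>\<pi>\<bar>"
    unfolding g by (simp add: abs_mult)
  also have "\<dots> \<le> (\<integral>z. \<bar>?g z\<bar> \<partial>\<pi>)" by (rule integral_abs_bound)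
  also have "\<dots> \<le> transport_cost p \<pi>"
  proof (rule integral_mono)
    show "integrable \<pi> (\<lambda>z. \<bar>?g z\<bar>)" using i by (rule integrable_abs)
    show "integrable \<pi> (\<lambda>z. dist (fst z) (snd z) powr p)"
      using p by (intro transport_cost_integrable[OF X(1) C(1)]) simp
    fix z assume "z \<in> space \<pi>"
    then have "z \<in> X \<times> X" unfolding P(3) .
    then have z: "fst z \<in> X" "snd z \<in> X" by (simp_all add: mem_Times_iff)
    show "\<bar>?g z\<bar> \<le> dist (fst z) (snd z) powr p"
    proof (cases "dist (fst z) (snd z) < r")
      case True
      then have "snd z \<in> ball (fst z) r" "fst z \<in> ball (snd z) r" by (auto simp: dist_commute)
      then have "X \<inter> ball (fst z) r = X \<inter> ball (snd z) r"
        using ultrametric_ball_eq[OF X(2) z] by simp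
      then have "x \<in> ball (fst z) r \<longleftrightarrow> x \<in> ball (snd z) r"
        using x by blast
      then have "fst z \<in> ball x r \<longleftrightarrow> snd z \<in> ball x r"
        by (simp add: dist_commute)
      then show ?thesis using z by (simp add: indicator_def)
    next
      case False
      then have "r powr p \<le> dist (fst z) (snd z) powr p" using r p by (intro powr_mono2) auto
      then show ?thesis by (auto simp: indicator_def)
    qed
  qed
  finally show ?thesis .
qed

lemma ball_mass_difference_le_wasserstein:
  fixes X :: "'a::metric_space set"
  assumes X: "compact X" "ultrametric_on X" and \<mu>: "\<mu> \<in> borel_probs X" and \<nu>: "\<nu> \<in> borel_probs X"
    and x: "x \<in> X" and r: "0 < r" and p: "0 < p"
  shows "r powr p * \<bar>measure \<mu> (X \<inter> ball x r) - measure \<nu> (X \<inter> ball x r)\<bar> \<le> wasserstein X p \<mu> \<nu> powr p"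
  unfolding wasserstein_powr[OF X(1) \<mu> \<nu> p]
  by (intro INF_transport_cost_greatest[OF X(1) \<mu> \<nu>] ball_mass_difference_le[OF X _ x r p])

text \<open>The uniqueness theorem for measures agreeing on an intersection-stable generator. Balls
  generate the Borel sets by separability, and two ultrametric balls that meet intersect in a
  ball.\<close>

lemma ultrametric_measure_eqI:
  fixes X :: "'a::metric_space set"
  assumes X: "compact X" "ultrametric_on X" and \<mu>: "\<mu> \<in> borel_probs X" and \<nu>: "\<nu> \<in> borel_probs X"
    and eq: "\<And>x r. x \<in> X \<Longrightarrow> 0 < r \<Longrightarrow> measure \<mu> (X \<inter> ball x r) = measure \<nu> (X \<inter> ball x r)"
  shows "\<mu> = \<nu>"
proof -
  obtain D where D: "countable D" "D \<subseteq> X" "\<And>x e. x \<in> X \<Longrightarrow> 0 < e \<Longrightarrow> \<exists>y\<in>D. dist x y < e"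
    using compact_separable[OF X(1)] by blast
  \<comment> \<open>The empty set is added because disjoint balls must also have their intersection
    in \<open>E\<close>.\<close>
  define E where "E = insert {} {X \<inter> ball x r |x r. x \<in> X \<and> 0 < r}"
  have EI: "X \<inter> ball x r \<in> E" if "x \<in> X" "0 < r" for x r using that by (auto simp: E_def)
  have E: "E \<subseteq> Pow X" by (auto simp: E_def)
  have gen: "sets (borel_of X) = sigma_sets X E"
  proof (rule antisym)
    show "sigma_sets X E \<subseteq> sets (borel_of X)"
    proof (rule sets.sigma_sets_subset'[of E "borel_of X" X])
      show "E \<subseteq> sets (borel_of X)" by (auto simp: E_def sets_restrict_space)
    qed (metis sets.top space_restrict_space space_borel Int_UNIV_right)
    have "sets (borel_of X) \<subseteq> sets (sigma X E)"
    proof (rule sets_borel_of_subset)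
      fix S :: "'a set" assume S: "open S"
      define I where "I = {(y, n). y \<in> D \<and> X \<inter> ball y (inverse (Suc n)) \<subseteq> S}"
      have "(\<Union>i\<in>I. X \<inter> ball (fst i) (inverse (Suc (snd i)))) \<in> sets (sigma X E)"
      proof (rule sets.countable_UN'')
        have "I \<subseteq> D \<times> UNIV" by (auto simp: I_def)
        moreover have "countable (D \<times> (UNIV::nat set))" using D(1) by (intro countable_SIGMA) auto
        ultimately show "countable I" by (rule countable_subset)
        fix i assume "i \<in> I"
        then have "X \<inter> ball (fst i) (inverse (Suc (snd i))) \<in> E"
          using D(2) by (intro EI) (auto simp: I_def)
        then show "X \<inter> ball (fst i) (inverse (Suc (snd i))) \<in> sets (sigma X E)"
          using E by (auto simp: sets_measure_of)
      qed
      also have "(\<Union>i\<in>I. X \<inter> ball (fst i) (inverse (Suc (snd i)))) = S \<inter> X"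
      proof (intro equalityI subsetI)
        fix z assume z: "z \<in> S \<inter> X"
        then obtain e where e: "0 < e" "ball z e \<subseteq> S" using S by (meson IntD1 open_contains_ball)
        obtain y n where "y \<in> D" "z \<in> ball y (inverse (Suc n))" "ball y (inverse (Suc n)) \<subseteq> ball z e"
          using dense_ball_refinement[OF D(3) IntD2[OF z] e(1)] by blast
        then have "(y, n) \<in> I" "z \<in> X \<inter> ball (fst (y, n)) (inverse (Suc (snd (y, n))))"
          using e(2) z by (auto simp: I_def)
        then show "z \<in> (\<Union>i\<in>I. X \<inter> ball (fst i) (inverse (Suc (snd i))))" by (rule UN_I)
      qed (auto simp: I_def)
      finally show "S \<inter> X \<in> sets (sigma X E)" .
    qed (simp add: space_measure_of_conv)
    then show "sets (borel_of X) \<subseteq> sigma_sets X E" using E by (simp add: sets_measure_of)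
  qed
  note M = borel_probsD[OF \<mu>] and N = borel_probsD[OF \<nu>]
  interpret M: prob_space \<mu> by (rule M)
  interpret N: prob_space \<nu> by (rule N)
  show ?thesis
  proof (rule measure_eqI_generator_eq_countable[where E = E and \<Omega> = X and A = "(\<lambda>y. X \<inter> ball y 1) ` D"])
    show "Int_stable E"
    proof (rule Int_stableI)
      fix a b assume "a \<in> E" "b \<in> E"
      show "a \<inter> b \<in> E"
      proof (cases "a \<inter> b = {}")
        case False
        then obtain x r y s where xy: "a = X \<inter> ball x r" "x \<in> X" "0 < r" "b = X \<inter> ball y s" "y \<in> X" "0 < s"
          using \<open>a \<in> E\<close> \<open>b \<in> E\<close> by (auto simp: E_def)
        obtain z where z: "z \<in> X" "z \<in> ball x r" "z \<in> ball y s" using False xy by auto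
        \<comment> \<open>A common point serves as centre of both balls, whose intersection is then
          the ball with the smaller radius.\<close>
        have "a = X \<inter> ball z r" "b = X \<inter> ball z s"
          using ultrametric_ball_eq[OF X(2) xy(2) z(1,2)] ultrametric_ball_eq[OF X(2) xy(5) z(1,3)] xy(1,4)
          by simp_all
        then have "a \<inter> b = X \<inter> ball z (min r s)" by auto
        then show ?thesis using EI[OF z(1), of "min r s"] xy(3,6) by simp
      qed (simp add: E_def)
    qed
    show "emeasure \<mu> A = emeasure \<nu> A" if "A \<in> E" for A
      using that eq by (auto simp: E_def M.emeasure_eq_measure N.emeasure_eq_measure)
    show "(\<lambda>y. X \<inter> ball y 1) ` D \<subseteq> E" using D(2) by (auto intro: EI)
    show "\<Union> ((\<lambda>y. X \<inter> ball y 1) ` D) = X"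
      using D(3)[of _ 1] by (auto simp: dist_commute)
    show "countable ((\<lambda>y. X \<inter> ball y 1) ` D)" using D(1) by simp
  qed (use E M N gen in auto)
qed

text \<open>Definiteness comes from the ball estimate: at distance zero the two measures give every
  ball the same mass.\<close>

lemma Metric_space_wasserstein_1:
  fixes X :: "'a::metric_space set"
  assumes X: "compact X" "ultrametric_on X"
  shows "Metric_space (borel_probs X) (wasserstein X 1)"
proof
  fix \<mu> \<nu> \<rho> :: "'a measure"
  show "0 \<le> wasserstein X 1 \<mu> \<nu>" by (simp add: wasserstein_def)
  show "wasserstein X 1 \<mu> \<nu> = wasserstein X 1 \<nu> \<mu>" using X(1) by (simp add: wasserstein_commute)
  assume \<mu>: "\<mu> \<in> borel_probs X" and \<nu>: "\<nu> \<in> borel_probs X"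
  show "wasserstein X 1 \<mu> \<nu> = 0 \<longleftrightarrow> \<mu> = \<nu>"
  proof
    assume "wasserstein X 1 \<mu> \<nu> = 0"
    then have "r * \<bar>measure \<mu> (X \<inter> ball x r) - measure \<nu> (X \<inter> ball x r)\<bar> \<le> 0" if "x \<in> X" "0 < r" for x r
      using ball_mass_difference_le_wasserstein[OF X \<mu> \<nu> that, of 1] that by simp
    then show "\<mu> = \<nu>"
      by (intro ultrametric_measure_eqI[OF X \<mu> \<nu>]) (force simp: mult_le_0_iff)
  next
    assume "\<mu> = \<nu>"
    then show "wasserstein X 1 \<mu> \<nu> = 0" using wasserstein_self[OF X(1) \<mu>, of 1] by simp
  qed
  assume "\<rho> \<in> borel_probs X"
  then show "wasserstein X 1 \<mu> \<rho> \<le> wasserstein X 1 \<mu> \<nu> + wasserstein X 1 \<nu> \<rho>"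
    using wasserstein_1_triangle[OF X(1) \<mu> \<nu>] by blast
qed

section \<open>Rigidity of arcs with a large Hoelder exponent\<close>

lemma holder_gt_1_constant:
  fixes f :: "real \<Rightarrow> real"
  assumes \<beta>: "1 < \<beta>" and f: "\<And>s t. s \<in> {0..1} \<Longrightarrow> t \<in> {0..1} \<Longrightarrow> \<bar>f s - f t\<bar> \<le> C * \<bar>s - t\<bar> powr \<beta>"
    and t: "t \<in> {0..1}"
  shows "f t = f 0"
proof -
  have "\<exists>c. \<forall>x\<in>{0..1}. f x = c"
  proof (rule has_field_derivative_zero_constant)
    fix x :: real assume x: "x \<in> {0..1}"
    have "((\<lambda>y. (f y - f x) / (y - x)) \<longlongrightarrow> 0) (at x within {0..1})"
    proof (rule Lim_null_comparison)
      \<comment> \<open>One factor \<open>\<bar>y - x\<bar>\<close> is split off from the Hoelder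
        bound, so the difference quotient is controlled by the positive power
        \<open>\<beta> - 1\<close> and the derivative is zero everywhere.\<close>
      have "norm ((f y - f x) / (y - x)) \<le> C * \<bar>y - x\<bar> powr (\<beta> - 1)" if "y \<in> {0..1}" "y \<noteq> x" for y
      proof -
        have "\<bar>f y - f x\<bar> \<le> C * \<bar>y - x\<bar> powr (\<beta> - 1) * \<bar>y - x\<bar>"
          using f[OF that(1) x] that by (simp add: powr_diff)
        then show ?thesis using that by (simp add: field_simps)
      qed
      then show "\<forall>\<^sub>F y in at x within {0..1}. norm ((f y - f x) / (y - x)) \<le> C * \<bar>y - x\<bar> powr (\<beta> - 1)"
        by (auto simp: eventually_at_filter)
      \<comment> \<open>The base of the power tends to 0, where \<open>powr\<close> is still
        continuous because \<open>\<beta> - 1\<close> is positive; the limit value is 0.\<close>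
      have "((\<lambda>y. C * \<bar>y - x\<bar> powr (\<beta> - 1)) \<longlongrightarrow> C * \<bar>x - x\<bar> powr (\<beta> - 1)) (at x within {0..1})"
        using \<beta> by (intro tendsto_intros tendsto_powr') auto
      then show "((\<lambda>y. C * \<bar>y - x\<bar> powr (\<beta> - 1)) \<longlongrightarrow> 0) (at x within {0..1})" by simp
    qed
    then show "(f has_field_derivative 0) (at x within {0..1})"
      by (simp add: has_field_derivative_iff)
  qed simp
  then show ?thesis using t by force
qed

lemma holder_arc_constant:
  fixes X :: "'a::metric_space set"
  assumes X: "compact X" "ultrametric_on X" and p: "0 < p" and \<alpha>: "1 / p < \<alpha>"
    and \<gamma>: "holder_arc (borel_probs X) (wasserstein X p) \<alpha> \<gamma>"
  shows "\<gamma> constant_on {0..1}"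
proof -
  obtain C where C: "\<And>s t. s \<in> {0..1} \<Longrightarrow> t \<in> {0..1} \<Longrightarrow> wasserstein X p (\<gamma> s) (\<gamma> t) \<le> C * \<bar>s - t\<bar> powr \<alpha>"
    using \<gamma> unfolding holder_arc_def by blast
  have \<gamma>P: "\<gamma> t \<in> borel_probs X" if "t \<in> {0..1}" for t
    using \<gamma> that unfolding holder_arc_def by blast
  \<comment> \<open>The Hoelder bound between times 0 and 1 forces \<open>C\<close> to be
    nonnegative, which is used to distribute the \<open>p\<close>-th power over the product
    below.\<close>
  have "0 \<le> wasserstein X p (\<gamma> 0) (\<gamma> 1)" by (simp add: wasserstein_def)
  also have "\<dots> \<le> C" using C[of 0 1] by simp
  finally have C0: "0 \<le> C" .
  have "\<gamma> t = \<gamma> 0" if t: "t \<in> {0..1}" for t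
  proof (rule ultrametric_measure_eqI[OF X])
    show "\<gamma> t \<in> borel_probs X" "\<gamma> 0 \<in> borel_probs X" using \<gamma>P t by auto
    fix x r assume x: "x \<in> X" and r: "(0::real) < r"
    let ?f = "\<lambda>t. measure (\<gamma> t) (X \<inter> ball x r)"
    have "1 < \<alpha> * p" using \<alpha> p by (simp add: field_simps)
    moreover have "\<bar>?f s - ?f t\<bar> \<le> C powr p / r powr p * \<bar>s - t\<bar> powr (\<alpha> * p)"
      if st: "s \<in> {0..1}" "t \<in> {0..1}" for s t
    proof -
      have "r powr p * \<bar>?f s - ?f t\<bar> \<le> wasserstein X p (\<gamma> s) (\<gamma> t) powr p"
        by (rule ball_mass_difference_le_wasserstein[OF X \<gamma>P[OF st(1)] \<gamma>P[OF st(2)] x r p])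
      also have "\<dots> \<le> (C * \<bar>s - t\<bar> powr \<alpha>) powr p"
        using p C[OF st] by (intro powr_mono2) (auto simp: wasserstein_def)
      also have "\<dots> = C powr p * \<bar>s - t\<bar> powr (\<alpha> * p)"
        using C0 by (simp add: powr_mult powr_powr)
      finally show ?thesis using r by (simp add: field_simps)
    qed
    ultimately show "?f t = ?f 0" using t by (rule holder_gt_1_constant)
  qed
  then show ?thesis unfolding constant_on_def by blast
qed

section \<open>Geodesics, connecting arcs and rigidity in the Wasserstein spaces\<close>

theorem corollary1p2:
  fixes X :: "'a::metric_space set"
  assumes "compact X" and "ultrametric_on X"
  shows "geodesic_space (borel_probs X) (wasserstein X 1) \<and>
    (\<forall>p::real. p > 1 \<longrightarrow>
       (\<forall>\<mu>\<in>borel_probs X. \<forall>\<nu>\<in>borel_probs X.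
          \<exists>\<gamma>. holder_arc (borel_probs X) (wasserstein X p) (1 / p) \<gamma> \<and> \<gamma> 0 = \<mu> \<and> \<gamma> 1 = \<nu>) \<and>
       (\<forall>\<alpha>::real. \<alpha> > 1 / p \<longrightarrow>
          (\<forall>\<gamma>. holder_arc (borel_probs X) (wasserstein X p) \<alpha> \<gamma> \<longrightarrow> \<gamma> constant_on {0..1})))"
proof (intro conjI allI impI ballI)
  interpret W: Metric_space "borel_probs X" "wasserstein X 1"
    using assms by (rule Metric_space_wasserstein_1)
  show "geodesic_space (borel_probs X) (wasserstein X 1)"
    unfolding geodesic_space_def
  proof (intro conjI ballI)
    fix \<mu> \<nu> assume "\<mu> \<in> borel_probs X" "\<nu> \<in> borel_probs X"
    then obtain \<pi> where \<pi>: "\<pi> \<in> couplings X \<mu> \<nu>" using couplings_nonempty[OF assms(1)] by blast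
    let ?\<gamma> = "interpolate X \<pi>" and ?d = "wasserstein X 1"
    note I = interpolate_in_borel_probs[OF \<pi>] and e = interpolate_endpoints[OF \<pi>]
    have le: "?d (?\<gamma> s) (?\<gamma> t) \<le> \<bar>s - t\<bar> * ?d \<mu> \<nu>" if "s \<in> {0..1}" "t \<in> {0..1}" for s t
      using wasserstein_interpolate_powr_le[OF assms(1) \<pi>, of 1, OF _ that] by simp
    have eq: "?d (?\<gamma> s) (?\<gamma> t) = (t - s) * ?d \<mu> \<nu>" if "0 \<le> s" "s \<le> t" "t \<le> 1" for s t
    proof (rule antisym)
      \<comment> \<open>The pieces from 0 to \<open>s\<close> and from \<open>t\<close> to 1 account
        for at most the shares \<open>s\<close> and \<open>1 - t\<close> of the total distance, so
        at least \<open>t - s\<close> of it is left for the middle piece.\<close>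
      have "?d \<mu> \<nu> \<le> ?d (?\<gamma> 0) (?\<gamma> s) + ?d (?\<gamma> s) (?\<gamma> t) + ?d (?\<gamma> t) (?\<gamma> 1)"
        using W.triangle[OF I[of 0] I[of s] I[of 1]] W.triangle[OF I[of s] I[of t] I[of 1]] e by simp
      also have "\<dots> \<le> s * ?d \<mu> \<nu> + ?d (?\<gamma> s) (?\<gamma> t) + (1 - t) * ?d \<mu> \<nu>"
        using le[of 0 s] le[of t 1] that by simp
      finally show "(t - s) * ?d \<mu> \<nu> \<le> ?d (?\<gamma> s) (?\<gamma> t)" by (simp add: algebra_simps)
    qed (use le[of s t] that in simp)
    have "?d (?\<gamma> s) (?\<gamma> t) = \<bar>s - t\<bar> * ?d \<mu> \<nu>" if "s \<in> {0..1}" "t \<in> {0..1}" for s t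
      using eq[of s t] eq[of t s] that W.commute[of "?\<gamma> s" "?\<gamma> t"] by (cases "s \<le> t") auto
    then show "\<exists>\<gamma>. \<gamma> \<in> {0..1} \<rightarrow> borel_probs X \<and> \<gamma> 0 = \<mu> \<and> \<gamma> 1 = \<nu> \<and>
        (\<forall>s\<in>{0..1}. \<forall>t\<in>{0..1}. ?d (\<gamma> s) (\<gamma> t) = \<bar>s - t\<bar> * ?d \<mu> \<nu>)"
      using I e by (intro exI[of _ ?\<gamma>]) auto
  qed (rule W.Metric_space_axioms)
next
  fix p :: real and \<mu> \<nu> assume p: "1 < p" and "\<mu> \<in> borel_probs X" "\<nu> \<in> borel_probs X"
  then obtain \<pi> where \<pi>: "\<pi> \<in> couplings X \<mu> \<nu>" using couplings_nonempty[OF assms(1)] by blast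
  let ?\<gamma> = "interpolate X \<pi>" and ?d = "wasserstein X p"
  \<comment> \<open>The distance of the endpoints serves as Hoelder constant: taking
    \<open>p\<close>-th roots turns the factor \<open>\<bar>s - t\<bar>\<close> of the cost into its
    power \<open>1 / p\<close>.\<close>
  have "?d (?\<gamma> s) (?\<gamma> t) \<le> ?d \<mu> \<nu> * \<bar>s - t\<bar> powr (1 / p)" if "s \<in> {0..1}" "t \<in> {0..1}" for s t
  proof -
    have nonneg: "0 \<le> ?d \<alpha> \<beta>" for \<alpha> \<beta> by (simp add: wasserstein_def)
    have "?d (?\<gamma> s) (?\<gamma> t) = (?d (?\<gamma> s) (?\<gamma> t) powr p) powr (1 / p)"
      using p nonneg by (simp add: powr_powr)
    also have "\<dots> \<le> (\<bar>s - t\<bar> * ?d \<mu> \<nu> powr p) powr (1 / p)"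
      using wasserstein_interpolate_powr_le[OF assms(1) \<pi> _ that, of p] p by (intro powr_mono2) auto
    also have "\<dots> = ?d \<mu> \<nu> * \<bar>s - t\<bar> powr (1 / p)"
      using p nonneg by (simp add: powr_mult powr_powr)
    finally show ?thesis .
  qed
  then have "holder_arc (borel_probs X) ?d (1 / p) ?\<gamma>"
    unfolding holder_arc_def using interpolate_in_borel_probs[OF \<pi>] by blast
  then show "\<exists>\<gamma>. holder_arc (borel_probs X) ?d (1 / p) \<gamma> \<and> \<gamma> 0 = \<mu> \<and> \<gamma> 1 = \<nu>"
    using interpolate_endpoints[OF \<pi>] by blast
next
  fix p \<alpha> :: real and \<gamma> assume "1 < p" "1 / p < \<alpha>" "holder_arc (borel_probs X) (wasserstein X p) \<alpha> \<gamma>"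
  then show "\<gamma> constant_on {0..1}" using holder_arc_constant[OF assms, of p \<alpha> \<gamma>] by simp
qed

end
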